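(* Let $K\subset\mathbb{C}^n$ be a nonpluripolar compact set. Then there exists a Borel probability measure $\nu$ on $K$ satisfying a strong Bernstein-Markov property.
   Context: $C(K)$ is the space of real-valued continuous functions on $K$. A Borel probability measure $\nu$ on $K$ satisfies a strong Bernstein-Markov property if for every $Q\in C(K)$ the triple $(K,\nu,Q)$ satisfies a weighted Bernstein-Markov property: there are constants $M_k$ ($k=1,2,\dots$, depending on $Q$) with $\limsup_{k\to\infty}M_k^{1/k}=1$ such that, for every $k$ and every holomorphic polynomial $p_k$ on $\mathbb{C}^n$ of degree at most $k$, $$\sup_{z\in K}|e^{-kQ(z)}p_k(z)|\le M_k\|e^{-kQ}p_k\|_{L^2(\nu)}.$$ *)

theory Defs
  imports "HOL-Probability.Probability"
begin

section \<open>Plurisubharmonic functions and pluripolar sets\<close>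

text \<open>
  Functions into \<open>[-\<infinity>, \<infinity>)\<close> are represented with values in the extended reals. The mean of such a
  function over the unit circle is taken as the integral of its positive part minus the integral of
  its negative part. For upper semicontinuous functions with values below \<open>\<infinity>\<close> the first
  integral is finite, so the value is the usual one, possibly \<open>-\<infinity>\<close>. The function
  \<^const>\<open>e2ennreal\<close> sends negative numbers to 0.
\<close>

definition circle_mean :: "(complex \<Rightarrow> ereal) \<Rightarrow> ereal" where
  "circle_mean v =
     (enn2ereal (\<integral>\<^sup>+\<theta>\<in>{0..2 * pi}. e2ennreal (v (cis \<theta>)) \<partial>lborel)
      - enn2ereal (\<integral>\<^sup>+\<theta>\<in>{0..2 * pi}. e2ennreal (- v (cis \<theta>)) \<partial>lborel)) / ereal (2 * pi)"

text \<open>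
  The constant function \<open>-\<infinity>\<close> is admitted here; it is excluded in the definition of pluripolar sets.
  The sub-mean value inequality is required for every closed disc of a complex line contained in \<open>\<Omega>\<close>
  (radii are absorbed in \<open>b\<close>).
\<close>

definition plurisubharmonic_on :: "(complex ^ 'n) set \<Rightarrow> (complex ^ 'n \<Rightarrow> ereal) \<Rightarrow> bool" where
  "plurisubharmonic_on \<Omega> u \<longleftrightarrow>
     open \<Omega> \<and>
     (\<forall>z\<in>\<Omega>. u z < \<infinity>) \<and>
     (\<forall>c. open {z \<in> \<Omega>. u z < c}) \<and>
     (\<forall>a b. (\<forall>\<zeta>. cmod \<zeta> \<le> 1 \<longrightarrow> a + \<zeta> *s b \<in> \<Omega>) \<longrightarrow>
        u a \<le> circle_mean (\<lambda>\<zeta>. u (a + \<zeta> *s b)))"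

definition pluripolar :: "(complex ^ 'n) set \<Rightarrow> bool" where
  "pluripolar E \<longleftrightarrow>
     (\<exists>u. plurisubharmonic_on UNIV u \<and> (\<exists>z. u z \<noteq> -\<infinity>) \<and> (\<forall>z\<in>E. u z = -\<infinity>))"

section \<open>Bernstein-Markov properties\<close>

definition holomorphic_polynomial_of_degree_le :: "nat \<Rightarrow> (complex ^ 'n \<Rightarrow> complex) \<Rightarrow> bool" where
  "holomorphic_polynomial_of_degree_le k p \<longleftrightarrow>
     (\<exists>c :: ('n \<Rightarrow> nat) \<Rightarrow> complex. \<forall>z.
        p z = (\<Sum>\<alpha> | (\<Sum>i\<in>UNIV. \<alpha> i) \<le> k. c \<alpha> * (\<Prod>i\<in>UNIV. (z $ i) ^ \<alpha> i)))"

definition Borel_probability_on :: "'a :: topological_space set \<Rightarrow> 'a measure \<Rightarrow> bool" where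
  "Borel_probability_on K \<nu> \<longleftrightarrow> prob_space \<nu> \<and> sets \<nu> = sets (restrict_space borel K)"

definition L2_norm :: "'a measure \<Rightarrow> ('a \<Rightarrow> complex) \<Rightarrow> real" where
  "L2_norm \<nu> f = sqrt (\<integral>z. (cmod (f z))\<^sup>2 \<partial>\<nu>)"

text \<open>
  Used for nonempty compact \<open>K\<close>, \<open>Q\<close> continuous on \<open>K\<close> and \<open>\<nu>\<close> a Borel probability measure on \<open>K\<close>, so
  that the supremum is of a nonempty bounded set and the integrand is bounded and measurable.
  Taking \<open>p = 1\<close> shows that the constants \<open>M k\<close> with \<open>k \<ge> 1\<close> are then positive; \<open>M 0\<close> plays no role.
\<close>

definition weighted_Bernstein_Markov ::
    "(complex ^ 'n) set \<Rightarrow> (complex ^ 'n) measure \<Rightarrow> (complex ^ 'n \<Rightarrow> real) \<Rightarrow> bool" where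
  "weighted_Bernstein_Markov K \<nu> Q \<longleftrightarrow>
     (\<exists>M :: nat \<Rightarrow> real.
        limsup (\<lambda>k. ereal (root k (M k))) = 1 \<and>
        (\<forall>k\<ge>1. \<forall>p. holomorphic_polynomial_of_degree_le k p \<longrightarrow>
           (SUP z\<in>K. cmod (of_real (exp (- real k * Q z)) * p z))
             \<le> M k * L2_norm \<nu> (\<lambda>z. of_real (exp (- real k * Q z)) * p z)))"

definition strong_Bernstein_Markov ::
    "(complex ^ 'n) set \<Rightarrow> (complex ^ 'n) measure \<Rightarrow> bool" where
  "strong_Bernstein_Markov K \<nu> \<longleftrightarrow>
     (\<forall>Q. continuous_on K Q \<longrightarrow> weighted_Bernstein_Markov K \<nu> Q)"

end

theory Submission
  imports Defs "Jordan_Normal_Form.Determinant"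
begin

text \<open>
  The measure is discrete. For bounded functions spanning a space of dimension at most \<open>N\<close>, points that
  nearly maximise a nonvanishing minor \<open>det (f\<^sub>i (z\<^sub>j))\<close> of maximal size \<open>r \<le> N\<close> (near-Fekete points)
  bound every function of the span by \<open>2\<close> times the sum of its absolute values at these points.
  This is applied to the weighted polynomials \<open>exp (- k G) p\<close> with \<open>p\<close> of degree at most \<open>k\<close>, where
  \<open>G\<close> runs through a countable family of bounded, possibly discontinuous functions approximating
  every continuous \<open>Q\<close> uniformly on \<open>K\<close>; then \<open>N\<close> is polynomial in \<open>k\<close>. All these points are charged
  with masses decaying only polynomially, so an \<open>\<epsilon>\<close>-approximation of \<open>Q\<close> gives the constant
  \<open>exp (2 k \<epsilon>)\<close> times a polynomial in \<open>k\<close>.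
\<close>

section \<open>Determinants and near-Fekete points\<close>

text \<open>Crude Leibniz bound. It serves to make the set of determinants bounded above, so that
  its supremum can be used.\<close>

lemma cmod_det_le:
  assumes "A \<in> carrier_mat n n" and "\<And>i j. i < n \<Longrightarrow> j < n \<Longrightarrow> cmod (A $$ (i, j)) \<le> B"
  shows "cmod (Determinant.det A) \<le> fact n * B ^ n"
proof -
  have term_le: "cmod (signof p * (\<Prod>i = 0..<n. A $$ (i, p i))) \<le> B ^ n"
    if p: "p permutes {0..<n}" for p
  proof -
    have "cmod (signof p * (\<Prod>i = 0..<n. A $$ (i, p i))) = (\<Prod>i = 0..<n. cmod (A $$ (i, p i)))"
      by (simp add: norm_mult sign_def flip: prod_norm)
    also have "\<dots> \<le> (\<Prod>i = 0..<n. B)"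
      using p by (intro prod_mono) (auto intro!: assms(2) simp: permutes_in_image[OF p])
    finally show ?thesis by simp
  qed
  have "cmod (Determinant.det A) \<le> (\<Sum>p | p permutes {0..<n}. B ^ n)"
    unfolding det_def'[OF assms(1)] by (rule order_trans[OF norm_sum sum_mono]) (use term_le in auto)
  also have "\<dots> = fact n * B ^ n"
    by (simp add: card_permutations)
  finally show ?thesis .
qed

text \<open>Lagrange interpolation by Cramer's rule: the coefficients are quotients of determinants
  in which one point has been exchanged for \<open>x\<close>. The denominator exceeds half the
  supremum of all such determinants, so each quotient is at most 2 in modulus. A maximum might not
  be attained, since the functions may be discontinuous.\<close>

lemma near_Fekete_points:
  fixes f :: "'i \<Rightarrow> 'a \<Rightarrow> complex"
  assumes A: "finite A" and bdd: "\<And>i. i \<in> A \<Longrightarrow> bounded (f i ` X)"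
  obtains r z where "r \<le> card A" "\<And>j. j < r \<Longrightarrow> z j \<in> X"
    "\<And>c x. x \<in> X \<Longrightarrow>
       cmod (\<Sum>i\<in>A. c i * f i x) \<le> 2 * (\<Sum>j<r. cmod (\<Sum>i\<in>A. c i * f i (z j)))"
proof -
  define F where "F I Z r = Matrix.mat r r (\<lambda>(a, b). f (I a) (Z b))"
    for I :: "nat \<Rightarrow> 'i" and Z :: "nat \<Rightarrow> 'a" and r
  have F_carrier: "F I Z r \<in> carrier_mat r r" for I Z r
    by (simp add: F_def)
  define nonsing where "nonsing r \<longleftrightarrow>
    (\<exists>I Z. I ` {..<r} \<subseteq> A \<and> Z ` {..<r} \<subseteq> X \<and> Determinant.det (F I Z r) \<noteq> 0)" for r
  \<comment> \<open>The empty determinant is 1, so a largest \<open>r\<close> exists even if all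
    \<open>f i\<close> vanish on \<open>X\<close>.\<close>
  have "nonsing 0"
    by (auto simp: nonsing_def det_def'[OF F_carrier])
  have nonsing_le: "r \<le> card A" if "nonsing r" for r
  proof (rule ccontr)
    assume "\<not> r \<le> card A"
    from that obtain I Z where I: "I ` {..<r} \<subseteq> A" and D: "Determinant.det (F I Z r) \<noteq> 0"
      by (auto simp: nonsing_def)
    \<comment> \<open>Pigeonhole: more than \<open>card A\<close> rows must repeat an index.\<close>
    from card_mono[OF A I] \<open>\<not> r \<le> card A\<close> have "\<not> inj_on I {..<r}"
      by (auto dest!: card_image)
    then obtain a b where "a < r" "b < r" "a \<noteq> b" "I a = I b"
      by (auto simp: inj_on_def)
    moreover have "row (F I Z r) a = row (F I Z r) b"
      using \<open>a < r\<close> \<open>b < r\<close> \<open>I a = I b\<close> by (auto simp: F_def)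
    ultimately show False
      using D det_identical_rows[OF F_carrier, of a b r I Z] by simp
  qed
  define r where "r = (GREATEST r. nonsing r)"
  have "nonsing r"
    unfolding r_def by (rule GreatestI_nat[where P = nonsing, OF \<open>nonsing 0\<close>]) (use nonsing_le in auto)
  have sing: "\<not> nonsing (Suc r)"
    using Greatest_le_nat[of nonsing "Suc r" "card A"] nonsing_le unfolding r_def by force
  from \<open>nonsing r\<close> obtain I Z0 where I: "I ` {..<r} \<subseteq> A" and Z0: "Z0 ` {..<r} \<subseteq> X"
    and D0: "Determinant.det (F I Z0 r) \<noteq> 0"
    by (auto simp: nonsing_def)
  \<comment> \<open>The row indices \<open>I\<close> stay fixed from here on; only the points
    vary.\<close>
  define \<D> where "\<D> = (\<lambda>Z. cmod (Determinant.det (F I Z r))) ` {Z. Z ` {..<r} \<subseteq> X}"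
  have "bounded (\<Union>i\<in>A. f i ` X)"
    using A bdd by (auto intro: bounded_UN)
  then obtain B where B: "\<And>i x. i \<in> A \<Longrightarrow> x \<in> X \<Longrightarrow> cmod (f i x) \<le> B"
    by (fastforce simp: bounded_iff)
  have "cmod (Determinant.det (F I Z r)) \<le> fact r * B ^ r" if "Z ` {..<r} \<subseteq> X" for Z
    using I that by (intro cmod_det_le[OF F_carrier]) (auto simp: F_def intro!: B)
  then have bdd_\<D>: "bdd_above \<D>"
    unfolding \<D>_def by (intro bdd_aboveI[of _ "fact r * B ^ r"]) auto
  have "cmod (Determinant.det (F I Z0 r)) \<le> Sup \<D>"
    by (rule cSup_upper[OF _ bdd_\<D>]) (use Z0 in \<open>auto simp: \<D>_def\<close>)
  with D0 have "Sup \<D> / 2 < Sup \<D>" and "Sup \<D> > 0"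
    using zero_less_norm_iff[of "Determinant.det (F I Z0 r)"] by linarith+
  moreover have "\<D> \<noteq> {}"
    using Z0 by (auto simp: \<D>_def)
  ultimately obtain Z where Z: "Z ` {..<r} \<subseteq> X"
    and half: "Sup \<D> / 2 < cmod (Determinant.det (F I Z r))"
    using less_cSupD[of \<D> "Sup \<D> / 2"] unfolding \<D>_def by blast
  define D where "D = Determinant.det (F I Z r)"
  have "D \<noteq> 0"
    using half \<open>Sup \<D> > 0\<close> by (auto simp: D_def)
  have D_max: "cmod (Determinant.det (F I Z' r)) \<le> 2 * cmod D" if "Z' ` {..<r} \<subseteq> X" for Z'
  proof -
    have "cmod (Determinant.det (F I Z' r)) \<le> Sup \<D>"
      by (rule cSup_upper[OF _ bdd_\<D>]) (use that in \<open>auto simp: \<D>_def\<close>)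
    then show ?thesis using half by (simp add: D_def)
  qed
  have "cmod (\<Sum>i\<in>A. c i * f i x) \<le> 2 * (\<Sum>j<r. cmod (\<Sum>i\<in>A. c i * f i (Z j)))"
    if x: "x \<in> X" for c x
  proof -
    \<comment> \<open>The new point \<open>x\<close> is appended as the point of index
      \<open>r\<close>.\<close>
    define W where "W = Z(r := x)"
    \<comment> \<open>Signed minor with column \<open>j\<close> deleted: \<open>W\<close> skips the
      index \<open>j\<close>. For \<open>j < r\<close> the remaining points are those of
      \<open>Z\<close> with \<open>Z j\<close> dropped and \<open>x\<close> added, so
      \<open>D_max\<close> applies.\<close>
    define E where "E j = (-1) ^ (r + j) * Determinant.det (F I (\<lambda>b. W (if b < j then b else Suc b)) r)"
      for j
    have W: "W b \<in> X" if "b < Suc r" for b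
      using that Z x by (auto simp: W_def less_Suc_eq)
    have E_le: "cmod (E j) \<le> 2 * cmod D" if "j < r" for j
      unfolding E_def norm_mult norm_power
      using that by (auto intro!: D_max W)
    \<comment> \<open>The bordered minor vanishes by maximality of \<open>r\<close>; its cofactors along the last row do not
      depend on the function \<open>f i\<close> in that row.\<close>
    have expand: "f i x * D = - (\<Sum>j<r. f i (Z j) * E j)" if i: "i \<in> A" for i
    proof -
      let ?M = "F (I(r := i)) W (Suc r)"
      have "Determinant.det ?M = 0"
      proof -
        have "(I(r := i)) ` {..<Suc r} \<subseteq> A"
          using I i by (auto simp: lessThan_Suc)
        moreover have "W ` {..<Suc r} \<subseteq> X"
          using W by auto
        ultimately show ?thesis
          using sing unfolding nonsing_def by blast
      qed
      moreover have "Determinant.det ?M = (\<Sum>j<Suc r. ?M $$ (r, j) * cofactor ?M r j)"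
        by (rule laplace_expansion_row[OF F_carrier]) simp
      moreover have "cofactor ?M r j = E j" if "j < Suc r" for j
      proof -
        have "mat_delete ?M r j = F I (\<lambda>b. W (if b < j then b else Suc b)) r"
          using that by (intro eq_matI) (auto simp: mat_delete_def F_def)
        then show ?thesis by (simp add: cofactor_def E_def)
      qed
      moreover have "E r = D"
      proof -
        have "F I (\<lambda>b. W (if b < r then b else Suc b)) r = F I Z r"
          by (intro eq_matI) (auto simp: F_def W_def)
        then show ?thesis by (simp add: E_def D_def)
      qed
      moreover have "?M $$ (r, j) = f i (W j)" if "j < Suc r" for j
        using that by (simp add: F_def)
      ultimately have "0 = (\<Sum>j<Suc r. f i (W j) * E j)"
        by simp
      also have "\<dots> = (\<Sum>j<r. f i (Z j) * E j) + f i x * D"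
        using \<open>E r = D\<close> by (simp add: W_def)
      finally show ?thesis by (simp add: eq_neg_iff_add_eq_0 add.commute)
    qed
    have "(\<Sum>i\<in>A. c i * f i x) * D = (\<Sum>i\<in>A. c i * (f i x * D))"
      by (simp add: sum_distrib_right mult.assoc)
    also have "\<dots> = - (\<Sum>i\<in>A. \<Sum>j<r. c i * f i (Z j) * E j)"
      by (simp add: expand sum_distrib_left sum_negf mult.assoc)
    also have "\<dots> = - (\<Sum>j<r. (\<Sum>i\<in>A. c i * f i (Z j)) * E j)"
      by (subst sum.swap) (simp add: sum_distrib_right)
    finally have "(\<Sum>i\<in>A. c i * f i x) * D = - (\<Sum>j<r. (\<Sum>i\<in>A. c i * f i (Z j)) * E j)" .
    from arg_cong[OF this, of cmod]
    have "cmod (\<Sum>i\<in>A. c i * f i x) * cmod D = cmod (\<Sum>j<r. (\<Sum>i\<in>A. c i * f i (Z j)) * E j)"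
      by (simp only: norm_minus_cancel norm_mult)
    also have "\<dots> \<le> (\<Sum>j<r. cmod (\<Sum>i\<in>A. c i * f i (Z j)) * (2 * cmod D))"
      by (rule order_trans[OF norm_sum sum_mono])
        (auto simp: norm_mult intro!: mult_left_mono E_le)
    also have "\<dots> = 2 * (\<Sum>j<r. cmod (\<Sum>i\<in>A. c i * f i (Z j))) * cmod D"
      by (simp add: sum_distrib_left sum_distrib_right mult_ac)
    finally show ?thesis
      using \<open>D \<noteq> 0\<close> by simp
  qed
  with nonsing_le[OF \<open>nonsing r\<close>] Z show thesis
    by (intro that[of r Z]) auto
qed

section \<open>Countable uniform approximation of continuous weights\<close>

text \<open>Step functions with rational values suffice: each point of \<open>K\<close> is sent to a
  nearby point of a finite net, and the function is read off there. Discontinuity is harmless, since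
  near-Fekete points call for bounded functions only.\<close>

lemma countable_uniform_approximation:
  fixes K :: "'a::metric_space set"
  assumes "compact K"
  obtains G :: "nat \<Rightarrow> 'a \<Rightarrow> real" where "\<And>q. bounded (G q ` K)"
    "\<And>Q e. continuous_on K Q \<Longrightarrow> e > 0 \<Longrightarrow> \<exists>q. \<forall>x\<in>K. \<bar>Q x - G q x\<bar> \<le> e"
proof -
  have "\<forall>n. \<exists>S. finite S \<and> S \<subseteq> K \<and> K \<subseteq> (\<Union>x\<in>S. ball x (inverse (Suc n)))"
    using seq_compact_imp_totally_bounded[of K] assms inverse_Suc
    unfolding compact_eq_seq_compact_metric by blast
  then obtain S where S: "\<And>n. finite (S n)" "\<And>n. S n \<subseteq> K"
    and cover: "\<And>n. K \<subseteq> (\<Union>x\<in>S n. ball x (inverse (Suc n)))"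
    by metis
  have "\<forall>n. \<forall>x\<in>K. \<exists>y\<in>S n. dist x y < inverse (Suc n)"
    using cover by (force simp: dist_commute)
  then obtain \<pi> where \<pi>: "\<And>n x. x \<in> K \<Longrightarrow> \<pi> n x \<in> S n"
    and dist_\<pi>: "\<And>n x. x \<in> K \<Longrightarrow> dist x (\<pi> n x) < inverse (Suc n)"
    by metis
  \<comment> \<open>Extensional functions on the finite net \<open>S n\<close> with rational values
    form a countable set.\<close>
  define \<G> where "\<G> = (\<Union>n. (\<lambda>\<phi> x. \<phi> (\<pi> n x)) ` (S n \<rightarrow>\<^sub>E (\<rat> :: real set)))"
  have "countable \<G>"
    unfolding \<G>_def using S(1) by (intro countable_UN countable_image countable_PiE countable_rat) auto
  have approx: "\<exists>g\<in>\<G>. \<forall>x\<in>K. \<bar>Q x - g x\<bar> \<le> e" if Q: "continuous_on K Q" and e: "e > 0"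
    for Q :: "'a \<Rightarrow> real" and e
  proof -
    \<comment> \<open>One half of \<open>e\<close> pays for moving \<open>x\<close> to its net
      point, the other for rounding the value there to a rational.\<close>
    from compact_uniformly_continuous[OF Q assms] e
    obtain d where d: "d > 0" "\<And>x y. x \<in> K \<Longrightarrow> y \<in> K \<Longrightarrow> dist x y < d \<Longrightarrow> dist (Q x) (Q y) < e / 2"
      unfolding uniformly_continuous_on_def by (metis dist_commute half_gt_zero)
    from reals_Archimedean[OF d(1)] obtain n where n: "inverse (Suc n) < d" ..
    have "\<forall>y. \<exists>t\<in>\<rat>. Q y < t \<and> t < Q y + e / 2"
      using e by (intro allI Rats_dense_in_real) simp
    then obtain t where t: "\<And>y. t y \<in> \<rat>" "\<And>y. Q y < t y" "\<And>y. t y < Q y + e / 2"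
      by metis
    let ?g = "\<lambda>x. restrict t (S n) (\<pi> n x)"
    have "?g \<in> \<G>"
      unfolding \<G>_def using t(1) by (intro UN_I[of n] imageI) auto
    moreover have "\<bar>Q x - ?g x\<bar> \<le> e" if "x \<in> K" for x
    proof -
      have "dist (Q x) (Q (\<pi> n x)) < e / 2"
        using d(2)[of x "\<pi> n x"] that \<pi>[OF that, of n] S(2)[of n] dist_\<pi>[OF that, of n] n by force
      then show ?thesis
        using t(2,3)[of "\<pi> n x"] \<pi>[OF that, of n] by (simp add: dist_real_def abs_if split: if_splits)
    qed
    ultimately show ?thesis
      by (intro bexI[where x = ?g]) simp_all
  qed
  have "\<G> \<noteq> {}"
    using approx[of "\<lambda>_. 0" 1] by auto
  have bdd: "bounded (g ` K)" if "g \<in> \<G>" for g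
  proof -
    from that obtain n \<phi> where g: "g = (\<lambda>x. \<phi> (\<pi> n x))" by (auto simp: \<G>_def)
    have "g ` K \<subseteq> \<phi> ` S n" using \<pi> by (auto simp: g)
    then show ?thesis using S(1) finite_imp_bounded finite_subset by blast
  qed
  show thesis
  proof (rule that[of "from_nat_into \<G>"])
    show "bounded (from_nat_into \<G> q ` K)" for q
      by (rule bdd) (rule from_nat_into[OF \<open>\<G> \<noteq> {}\<close>])
    show "\<exists>q. \<forall>x\<in>K. \<bar>Q x - from_nat_into \<G> q x\<bar> \<le> e" if "continuous_on K Q" "e > 0" for Q e
      using approx[OF that] \<open>countable \<G>\<close> by (metis from_nat_into_surj)
  qed
qed

section \<open>A slowly decaying distribution on the natural numbers\<close>

text \<open>A geometric distribution would not do: the mass at \<open>k\<close> must not decay exponentially.\<close>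

definition slow_pmf :: "nat pmf" where
  "slow_pmf = embed_pmf (\<lambda>i. 1 / ((real i + 1) * (real i + 2)))"

text \<open>The total mass telescopes, the weight being
  \<open>1 / (i + 1) - 1 / (i + 2)\<close>.\<close>

lemma pmf_slow_pmf: "pmf slow_pmf i = 1 / ((real i + 1) * (real i + 2))"
  unfolding slow_pmf_def
proof (rule pmf_embed_pmf)
  have "(\<lambda>i. 1 / (real i + 1)) \<longlonglongrightarrow> 0"
    using LIMSEQ_inverse_real_of_nat by (simp add: inverse_eq_divide add.commute)
  note telescope_sums'[OF this]
  moreover have "1 / (real n + 1) - 1 / (real (Suc n) + 1) = 1 / ((real n + 1) * (real n + 2))" for n
    by (simp add: field_simps)
  ultimately have "(\<lambda>i. 1 / ((real i + 1) * (real i + 2))) sums 1"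
    by simp
  then show "(\<integral>\<^sup>+ i. ennreal (1 / ((real i + 1) * (real i + 2))) \<partial>count_space UNIV) = 1"
    unfolding nn_integral_count_space_nat by (subst suminf_ennreal_eq[where x = 1]) simp_all
qed simp

text \<open>A perfect square as lower bound: the L2 estimate takes the square root of the
  mass.\<close>

lemma pmf_slow_pmf_ge: "(1 / (real i + 2))\<^sup>2 \<le> pmf slow_pmf i"
proof -
  have "1 / ((real i + 2) * (real i + 2)) \<le> 1 / ((real i + 1) * (real i + 2))"
    by (intro divide_left_mono mult_right_mono) auto
  then show ?thesis
    by (simp add: pmf_slow_pmf power2_eq_square)
qed

section \<open>Weighted polynomials of bounded degree\<close>

lemma multidegree_le_subset:
  "{\<alpha> :: 'n::finite \<Rightarrow> nat. (\<Sum>i\<in>UNIV. \<alpha> i) \<le> k} \<subseteq> (UNIV \<rightarrow>\<^sub>E {..k})"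
proof
  fix \<alpha> :: "'n \<Rightarrow> nat"
  assume "\<alpha> \<in> {\<alpha>. (\<Sum>i\<in>UNIV. \<alpha> i) \<le> k}"
  moreover have "\<alpha> i \<le> (\<Sum>i\<in>UNIV. \<alpha> i)" for i
    by (rule member_le_sum) auto
  ultimately show "\<alpha> \<in> UNIV \<rightarrow>\<^sub>E {..k}"
    by (auto intro: order_trans)
qed

lemma finite_multidegree_le: "finite {\<alpha> :: 'n::finite \<Rightarrow> nat. (\<Sum>i\<in>UNIV. \<alpha> i) \<le> k}"
  by (rule finite_subset[OF multidegree_le_subset finite_PiE]) auto

text \<open>Counting a cube instead of a simplex is wasteful, but only polynomial growth in
  \<open>k\<close> matters.\<close>

lemma card_multidegree_le:
  "card {\<alpha> :: 'n::finite \<Rightarrow> nat. (\<Sum>i\<in>UNIV. \<alpha> i) \<le> k} \<le> (k + 1) ^ CARD('n)"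
proof -
  have "card {\<alpha> :: 'n \<Rightarrow> nat. (\<Sum>i\<in>UNIV. \<alpha> i) \<le> k} \<le> card ((UNIV :: 'n set) \<rightarrow>\<^sub>E {..k})"
    by (rule card_mono[OF finite_PiE multidegree_le_subset]) auto
  then show ?thesis
    by (simp add: card_PiE)
qed

text \<open>The zero function is plurisubharmonic, which makes the empty set pluripolar.\<close>

lemma not_pluripolar_imp_nonempty:
  assumes "\<not> pluripolar K"
  shows "K \<noteq> {}"
proof
  assume "K = {}"
  moreover have "plurisubharmonic_on UNIV (\<lambda>z :: complex ^ 'n. 0)"
    by (simp add: plurisubharmonic_on_def circle_mean_def)
  ultimately show False
    using assms unfolding pluripolar_def by force
qed

lemma continuous_on_holomorphic_polynomial:
  assumes "holomorphic_polynomial_of_degree_le k p"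
  shows "continuous_on S p"
proof -
  from assms obtain c where
    c: "p = (\<lambda>z. \<Sum>\<alpha> | (\<Sum>i\<in>UNIV. \<alpha> i) \<le> k. c \<alpha> * (\<Prod>i\<in>UNIV. (z $ i) ^ \<alpha> i))"
    unfolding holomorphic_polynomial_of_degree_le_def by auto
  show ?thesis
    unfolding c by (intro continuous_intros)
qed

text \<open>The near-Fekete bound for the weighted monomials. The points depend on \<open>k\<close>
  and \<open>G\<close> but not on \<open>p\<close>.\<close>

lemma weighted_polynomial_near_Fekete_points:
  fixes K :: "(complex ^ 'n) set"
  assumes K: "compact K" and G: "bounded (G ` K)"
  obtains r z where "r \<le> (k + 1) ^ CARD('n)" "\<And>j. j < r \<Longrightarrow> z j \<in> K"
    "\<And>p x. holomorphic_polynomial_of_degree_le k p \<Longrightarrow> x \<in> K \<Longrightarrow>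
       cmod (of_real (exp (- real k * G x)) * p x)
         \<le> 2 * (\<Sum>j<r. cmod (of_real (exp (- real k * G (z j))) * p (z j)))"
proof -
  define A where "A = {\<alpha> :: 'n \<Rightarrow> nat. (\<Sum>i\<in>UNIV. \<alpha> i) \<le> k}"
  define f where "f \<alpha> x = complex_of_real (exp (- real k * G x)) * (\<Prod>i\<in>UNIV. (x $ i) ^ \<alpha> i)"
    for \<alpha> :: "'n \<Rightarrow> nat" and x :: "complex ^ 'n"
  have "finite A"
    unfolding A_def by (rule finite_multidegree_le)
  have f_bdd: "bounded (f \<alpha> ` K)" for \<alpha>
  proof -
    from G obtain B where B: "\<And>x. x \<in> K \<Longrightarrow> \<bar>G x\<bar> \<le> B"
      by (auto simp: bounded_iff)
    have "bounded ((\<lambda>x. \<Prod>i\<in>UNIV. (x $ i) ^ \<alpha> i) ` K)"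
      by (intro compact_imp_bounded compact_continuous_image K continuous_intros)
    then obtain C where C: "\<And>x. x \<in> K \<Longrightarrow> cmod (\<Prod>i\<in>UNIV. (x $ i) ^ \<alpha> i) \<le> C"
      by (auto simp: bounded_iff)
    have "cmod (f \<alpha> x) \<le> exp (real k * B) * C" if "x \<in> K" for x
    proof -
      have "- real k * G x \<le> real k * B"
        using B[OF that] mult_left_mono[of "- G x" B "real k"] by simp
      then show ?thesis
        unfolding f_def norm_mult using C[OF that] by (intro mult_mono) auto
    qed
    then show ?thesis by (auto simp: bounded_iff)
  qed
  obtain r z where r: "r \<le> card A" and z: "\<And>j. j < r \<Longrightarrow> z j \<in> K"
    and le: "\<And>c x. x \<in> K \<Longrightarrow>
       cmod (\<Sum>\<alpha>\<in>A. c \<alpha> * f \<alpha> x) \<le> 2 * (\<Sum>j<r. cmod (\<Sum>\<alpha>\<in>A. c \<alpha> * f \<alpha> (z j)))"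
    by (rule near_Fekete_points[where A = A and f = f and X = K, OF \<open>finite A\<close> f_bdd]) (rule that)
  show thesis
  proof (rule that[OF _ z])
    show "r \<le> (k + 1) ^ CARD('n)"
      using r card_multidegree_le[where 'n = 'n, of k] by (simp add: A_def)
    fix p :: "complex ^ 'n \<Rightarrow> complex" and x :: "complex ^ 'n"
    assume p: "holomorphic_polynomial_of_degree_le k p" and x: "x \<in> K"
    from p obtain c where c: "\<And>z. p z = (\<Sum>\<alpha>\<in>A. c \<alpha> * (\<Prod>i\<in>UNIV. (z $ i) ^ \<alpha> i))"
      unfolding holomorphic_polynomial_of_degree_le_def A_def by auto
    have "of_real (exp (- real k * G y)) * p y = (\<Sum>\<alpha>\<in>A. c \<alpha> * f \<alpha> y)" for y
      by (simp add: c f_def sum_distrib_left mult_ac)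
    then show "cmod (of_real (exp (- real k * G x)) * p x)
        \<le> 2 * (\<Sum>j<r. cmod (of_real (exp (- real k * G (z j))) * p (z j)))"
      using le[OF x] by simp
  qed
qed

section \<open>Point values against the L2 norm of a discrete measure\<close>

text \<open>The integral of the square is at least the contribution of the single atom
  \<open>t\<close>. Under the image measure, coinciding points \<open>Z t\<close> merely add up
  their masses.\<close>

lemma sqrt_pmf_mult_le_L2_norm:
  fixes h :: "'a::metric_space \<Rightarrow> complex" and Z :: "'b \<Rightarrow> 'a"
  assumes K: "compact K" and h: "continuous_on K h" and Z: "\<And>t. Z t \<in> K"
  shows "sqrt (pmf P t) * cmod (h (Z t))
    \<le> L2_norm (distr (measure_pmf P) (restrict_space borel K) Z) h"
proof -
  have Z_meas: "Z \<in> measurable (measure_pmf P) (restrict_space borel K)"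
    using Z by (auto simp: measurable_def space_restrict_space)
  have h_meas: "(\<lambda>x. (cmod (h x))\<^sup>2) \<in> borel_measurable (restrict_space borel K)"
    by (intro borel_measurable_continuous_on_restrict continuous_intros h)
  obtain B where B: "\<And>x. x \<in> K \<Longrightarrow> cmod (h x) \<le> B"
    using compact_imp_bounded[OF compact_continuous_image[OF h K]] by (auto simp: bounded_iff)
  have int: "integrable (measure_pmf P) (\<lambda>s. (cmod (h (Z s)))\<^sup>2)"
    by (rule measure_pmf.integrable_const_bound[where B = "B\<^sup>2"])
      (auto intro!: AE_I2 power_mono B Z)
  have int_ind: "integrable (measure_pmf P) (\<lambda>s. (cmod (h (Z t)))\<^sup>2 * indicator {t} s)"
    by (intro integrable_mult_right integrable_real_indicator)
      (auto simp: measure_pmf.emeasure_eq_measure)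
  have "(sqrt (pmf P t) * cmod (h (Z t)))\<^sup>2 = (\<integral>s. (cmod (h (Z t)))\<^sup>2 * indicator {t} s \<partial>measure_pmf P)"
    by (simp add: power_mult_distrib measure_pmf_single)
  also have "\<dots> \<le> (\<integral>s. (cmod (h (Z s)))\<^sup>2 \<partial>measure_pmf P)"
    by (rule integral_mono[OF int_ind int]) (auto simp: indicator_def)
  also have "\<dots> = (\<integral>x. (cmod (h x))\<^sup>2 \<partial>distr (measure_pmf P) (restrict_space borel K) Z)"
    by (rule integral_distr[OF Z_meas h_meas, symmetric])
  finally show ?thesis
    unfolding L2_norm_def by (rule real_le_rsqrt)
qed

section \<open>Growth of the Bernstein-Markov constants\<close>

text \<open>For fixed \<open>m\<close> the \<open>k\<close>-th root tends to
  \<open>exp (2 / (m + 1))\<close>, because constants and powers of \<open>k + 2\<close> disappear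
  in the limit. Letting \<open>m\<close> grow afterwards pushes the upper bound to 1; the lower
  bound holds because every term is at least 1.\<close>

lemma root_INF_exp_poly_tendsto_1:
  fixes C :: "nat \<Rightarrow> real"
  assumes C: "\<And>m. C m \<ge> 1"
  shows "(\<lambda>k. root k (INF m. exp (2 / (real m + 1)) ^ k * (C m * (real k + 2) ^ D))) \<longlonglongrightarrow> 1"
proof -
  define a where "a k m = exp (2 / (real m + 1)) ^ k * (C m * (real k + 2) ^ D)" for k m
  have a_ge: "1 \<le> a k m" for k m
  proof -
    have "1 * (1 * 1) \<le> a k m"
      unfolding a_def
      by (intro mult_mono one_le_power C) (auto intro: order_trans[OF zero_le_one C])
    then show ?thesis by simp
  qed
  have bdd: "bdd_below (range (a k))" for k
    using a_ge by (intro bdd_belowI) auto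
  have INF_ge: "1 \<le> (INF m. a k m)" for k
    using a_ge by (intro cINF_greatest) auto
  have root_a: "(\<lambda>k. root k (a k m)) \<longlonglongrightarrow> exp (2 / (real m + 1))" for m
  proof -
    have lim: "(\<lambda>k. root k (real k + 2)) \<longlonglongrightarrow> 1"
    proof (rule tendsto_sandwich)
      show "\<forall>\<^sub>F k in sequentially. 1 \<le> root k (real k + 2)"
        using eventually_gt_at_top[of 0] by eventually_elim simp
      \<comment> \<open>The constant 3 comes from \<open>k + 2 \<le> 3 * k\<close> for
        \<open>k \<ge> 1\<close>.\<close>
      show "\<forall>\<^sub>F k in sequentially. root k (real k + 2) \<le> root k 3 * root k (real k)"
        using eventually_gt_at_top[of 0]
        by eventually_elim (subst real_root_mult[symmetric], intro real_root_le_mono, auto)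
      show "(\<lambda>k. root k 3 * root k (real k)) \<longlonglongrightarrow> 1"
        using tendsto_mult[OF LIMSEQ_root_const[of 3] LIMSEQ_root] by simp
    qed auto
    have "C m > 0"
      using C[of m] by linarith
    have "(\<lambda>k. exp (2 / (real m + 1)) * (root k (C m) * root k (real k + 2) ^ D))
        \<longlonglongrightarrow> exp (2 / (real m + 1)) * (1 * 1 ^ D)"
      by (intro tendsto_intros lim LIMSEQ_root_const \<open>C m > 0\<close>)
    moreover have "\<forall>\<^sub>F k in sequentially.
        exp (2 / (real m + 1)) * (root k (C m) * root k (real k + 2) ^ D) = root k (a k m)"
      using eventually_gt_at_top[of 0]
      by eventually_elim (simp add: a_def real_root_mult real_root_power real_root_power_cancel)
    ultimately show ?thesis
      by (simp add: tendsto_cong)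
  qed
  have "(\<lambda>k. root k (INF m. a k m)) \<longlonglongrightarrow> 1"
  proof (rule order_tendstoI)
    fix b :: real assume "b < 1"
    show "\<forall>\<^sub>F k in sequentially. b < root k (INF m. a k m)"
      using eventually_gt_at_top[of 0]
    proof eventually_elim
      case (elim k)
      then have "1 \<le> root k (INF m. a k m)" using INF_ge[of k] by simp
      with \<open>b < 1\<close> show ?case by linarith
    qed
  next
    fix b :: real assume b: "1 < b"
    have "(\<lambda>m. 2 * (1 / (real m + 1))) \<longlonglongrightarrow> 2 * 0"
      using LIMSEQ_inverse_real_of_nat
      by (intro tendsto_mult tendsto_const) (simp add: inverse_eq_divide add.commute)
    then have "(\<lambda>m. exp (2 / (real m + 1))) \<longlonglongrightarrow> exp 0"
      by (intro tendsto_exp) simp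
    then have "\<forall>\<^sub>F m in sequentially. exp (2 / (real m + 1)) < b"
      using b by (intro order_tendstoD(2)) auto
    \<comment> \<open>This \<open>m\<close> depends on \<open>b\<close> alone and is fixed before
      \<open>k\<close> tends to infinity.\<close>
    then obtain m where "exp (2 / (real m + 1)) < b"
      by (auto simp: eventually_sequentially)
    with root_a have "\<forall>\<^sub>F k in sequentially. root k (a k m) < b"
      by (rule order_tendstoD(2))
    with eventually_gt_at_top[of 0] show "\<forall>\<^sub>F k in sequentially. root k (INF m. a k m) < b"
    proof eventually_elim
      case (elim k)
      have "root k (INF m. a k m) \<le> root k (a k m)"
        using elim(1) by (intro real_root_le_mono cINF_lower[OF bdd]) auto
      with elim(2) show ?case by linarith
    qed
  qed
  then show ?thesis by (simp only: a_def)
qed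

section \<open>The discrete measure and its strong Bernstein-Markov property\<close>

theorem corollary3p8:
  fixes K :: "(complex ^ 'n) set"
  assumes "compact K" and "\<not> pluripolar K"
  shows "\<exists>\<nu>. Borel_probability_on K \<nu> \<and> strong_Bernstein_Markov K \<nu>"
proof -
  let ?d = "CARD('n)"
  have K: "compact K" by fact
  have "K \<noteq> {}" using not_pluripolar_imp_nonempty assms(2) .
  then obtain x0 where x0: "x0 \<in> K" by auto
  obtain G :: "nat \<Rightarrow> complex ^ 'n \<Rightarrow> real" where G_bdd: "\<And>q. bounded (G q ` K)"
    and G_dense: "\<And>Q e. continuous_on K Q \<Longrightarrow> e > 0 \<Longrightarrow> \<exists>q. \<forall>x\<in>K. \<bar>Q x - G q x\<bar> \<le> e"
    using countable_uniform_approximation[OF K] by blast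
  \<comment> \<open>Bundling the properties in one predicate lets \<open>r\<close> and
    \<open>z\<close> be chosen as functions of the degree \<open>k\<close> and the weight index
    \<open>q\<close>.\<close>
  define near_Fekete where "near_Fekete k q r z \<longleftrightarrow> r \<le> (k + 1) ^ ?d \<and> (\<forall>j<r. z j \<in> K) \<and>
    (\<forall>p. holomorphic_polynomial_of_degree_le k p \<longrightarrow> (\<forall>x\<in>K.
       cmod (of_real (exp (- real k * G q x)) * p x)
         \<le> 2 * (\<Sum>j<r. cmod (of_real (exp (- real k * G q (z j))) * p (z j)))))"
    for k q r and z :: "nat \<Rightarrow> complex ^ 'n"
  have "\<exists>r z. near_Fekete k q r z" for k q
    unfolding near_Fekete_def
    by (rule weighted_polynomial_near_Fekete_points[OF K G_bdd, of k q]) blast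
  then obtain r z where rz: "\<And>k q. near_Fekete k q (r k q) (z k q)"
    by metis
  have r_le: "r k q \<le> (k + 1) ^ ?d" and z: "j < r k q \<Longrightarrow> z k q j \<in> K"
    and Fekete: "\<And>p x. holomorphic_polynomial_of_degree_le k p \<Longrightarrow> x \<in> K \<Longrightarrow>
      cmod (of_real (exp (- real k * G q x)) * p x)
         \<le> 2 * (\<Sum>j<r k q. cmod (of_real (exp (- real k * G q (z k q j))) * p (z k q j)))"
    for k q j
    using rz[of k q] by (auto simp: near_Fekete_def)
  \<comment> \<open>Independent random choice of a degree \<open>k\<close>, a weight index
    \<open>q\<close> and a point index \<open>j\<close>.\<close>
  define P where "P = pair_pmf slow_pmf (pair_pmf slow_pmf slow_pmf)"
  \<comment> \<open>Indices \<open>j\<close> beyond the number of points are sent to the default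
    point \<open>x0\<close>, so that all mass lies on \<open>K\<close>.\<close>
  define Z where "Z = (\<lambda>(k, q, j). if j < r k q then z k q j else x0)"
  have Z: "Z t \<in> K" for t
    using z x0 by (auto simp: Z_def split: prod.split)
  define \<nu> where "\<nu> = distr (measure_pmf P) (restrict_space borel K) Z"
  have "Borel_probability_on K \<nu>"
    unfolding Borel_probability_on_def \<nu>_def using Z
    by (auto intro!: measure_pmf.prob_space_distr simp: measurable_def space_restrict_space)
  moreover have "weighted_Bernstein_Markov K \<nu> Q" if Q: "continuous_on K Q" for Q
  proof -
    have "\<forall>m. \<exists>q. \<forall>x\<in>K. \<bar>Q x - G q x\<bar> \<le> 1 / (real m + 1)"
      using G_dense[OF Q] by simp
    then obtain q where q: "\<And>m x. x \<in> K \<Longrightarrow> \<bar>Q x - G (q m) x\<bar> \<le> 1 / (real m + 1)"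
      by metis
    \<comment> \<open>Passing from \<open>Q\<close> to \<open>G (q m)\<close> and back costs
      \<open>exp (1 / (m + 1)) ^ k\<close> each time. The 6 is the 2 of the near-Fekete bound times
      the 3 of \<open>j + 2 \<le> 3 * ?N\<close>. The factor \<open>q m + 2\<close> stems from the
      mass of \<open>q m\<close>; the exponent counts \<open>?d\<close> for the number of points,
      \<open>?d\<close> for the mass of \<open>j\<close> and 1 for the mass of
      \<open>k\<close>.\<close>
    define a where
      "a k m = exp (2 / (real m + 1)) ^ k * (6 * (real (q m) + 2) * (real k + 2) ^ (2 * ?d + 1))"
      for k m
    have bound: "cmod (of_real (exp (- real k * Q x)) * p x)
        \<le> a k m * L2_norm \<nu> (\<lambda>z. of_real (exp (- real k * Q z)) * p z)"
      if p: "holomorphic_polynomial_of_degree_le k p" and x: "x \<in> K" for k m p x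
    proof -
      let ?h = "\<lambda>z. of_real (exp (- real k * Q z)) * p z"
      let ?g = "\<lambda>z. of_real (exp (- real k * G (q m) z)) * p z"
      let ?L = "L2_norm \<nu> ?h" and ?e = "exp (1 / (real m + 1)) ^ k" and ?r = "r k (q m)"
      let ?N = "(real k + 2) ^ ?d"
      have h: "continuous_on K ?h"
        by (intro continuous_intros Q continuous_on_holomorphic_polynomial[OF p])
      have L: "?L \<ge> 0"
        by (simp add: L2_norm_def)
      have exp_le: "exp (- real k * u) \<le> ?e * exp (- real k * v)" if "v - u \<le> 1 / (real m + 1)" for u v
      proof -
        have "real k * (v - u) \<le> real k * (1 / (real m + 1))"
          using that by (rule mult_left_mono) simp
        then have "- real k * u \<le> real k * (1 / (real m + 1)) + - real k * v"
          by (simp add: algebra_simps)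
        then show ?thesis
          by (simp only: exp_of_nat_mult[symmetric] exp_add[symmetric] exp_le_cancel_iff)
      qed
      have hg: "cmod (?h y) \<le> ?e * cmod (?g y)" and gh: "cmod (?g y) \<le> ?e * cmod (?h y)"
        if "y \<in> K" for y
      proof -
        have *: "\<bar>Q y - G (q m) y\<bar> \<le> 1 / (real m + 1)"
          by (rule q[OF that])
        have "exp (- real k * Q y) \<le> ?e * exp (- real k * G (q m) y)"
          by (rule exp_le) (use * in linarith)
        from mult_right_mono[OF this norm_ge_zero[of "p y"]]
        show "cmod (?h y) \<le> ?e * cmod (?g y)"
          by (simp add: norm_mult mult.assoc)
        have "exp (- real k * G (q m) y) \<le> ?e * exp (- real k * Q y)"
          by (rule exp_le) (use * in linarith)
        from mult_right_mono[OF this norm_ge_zero[of "p y"]]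
        show "cmod (?g y) \<le> ?e * cmod (?h y)"
          by (simp add: norm_mult mult.assoc)
      qed
      have r_le_N: "real ?r \<le> ?N"
      proof -
        have "real ?r \<le> real ((k + 1) ^ ?d)"
          using r_le[of k "q m"] by (simp only: of_nat_le_iff)
        also have "\<dots> \<le> ?N"
          unfolding of_nat_power by (intro power_mono) auto
        finally show ?thesis .
      qed
      have h_le: "cmod (?h (z k (q m) j)) \<le> (real k + 2) * (real (q m) + 2) * (3 * ?N) * ?L"
        if j: "j < ?r" for j
      proof -
        \<comment> \<open>The reciprocal of \<open>?w\<close> is a lower bound for the square root
          of the mass of \<open>(k, q m, j)\<close>.\<close>
        let ?w = "(real k + 2) * (real (q m) + 2) * (real j + 2)"
        have w: "?w > 0" by (intro mult_pos_pos) auto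
        have "(1 / ?w)\<^sup>2 = (1 / (real k + 2))\<^sup>2 * ((1 / (real (q m) + 2))\<^sup>2 * (1 / (real j + 2))\<^sup>2)"
          by (simp add: power_divide power_mult_distrib)
        also have "\<dots> \<le> pmf P (k, q m, j)"
          unfolding P_def pmf_pair by (intro mult_mono pmf_slow_pmf_ge) auto
        finally have "1 / ?w \<le> sqrt (pmf P (k, q m, j))"
          by (rule real_le_rsqrt)
        then have "1 / ?w * cmod (?h (Z (k, q m, j))) \<le> ?L"
          using sqrt_pmf_mult_le_L2_norm[OF K h Z, of P "(k, q m, j)"] unfolding \<nu>_def
          by (meson mult_right_mono norm_ge_zero order_trans)
        moreover have "Z (k, q m, j) = z k (q m) j"
          using j by (simp add: Z_def)
        ultimately have "cmod (?h (z k (q m) j)) \<le> ?w * ?L"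
          using w by (simp add: divide_le_eq mult.commute)
        also have "\<dots> \<le> (real k + 2) * (real (q m) + 2) * (3 * ?N) * ?L"
        proof (intro mult_right_mono mult_left_mono L)
          have "1 \<le> ?N" by (rule one_le_power) simp
          then show "real j + 2 \<le> 3 * ?N"
            using r_le_N j by linarith
        qed auto
        finally show ?thesis .
      qed
      \<comment> \<open>The weight is switched to \<open>G (q m)\<close> at \<open>x\<close>, the
        near-Fekete bound is applied, and the weight is switched back at the chosen points.\<close>
      have "cmod (?h x) \<le> ?e * (2 * (\<Sum>j<?r. cmod (?g (z k (q m) j))))"
        by (rule order_trans[OF hg[OF x] mult_left_mono[OF Fekete[OF p x]]]) simp
      also have "\<dots> \<le> ?e * (2 * (\<Sum>j<?r. ?e * ((real k + 2) * (real (q m) + 2) * (3 * ?N) * ?L)))"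
      proof (intro mult_left_mono sum_mono)
        fix j assume "j \<in> {..<?r}"
        then have j: "j < ?r" by simp
        show "cmod (?g (z k (q m) j)) \<le> ?e * ((real k + 2) * (real (q m) + 2) * (3 * ?N) * ?L)"
          by (rule order_trans[OF gh[OF z[OF j]] mult_left_mono[OF h_le[OF j]]]) simp
      qed auto
      also have "\<dots> = real ?r * (?e * (2 * (?e * ((real k + 2) * (real (q m) + 2) * (3 * ?N) * ?L))))"
        by (simp add: mult_ac)
      also have "\<dots> \<le> ?N * (?e * (2 * (?e * ((real k + 2) * (real (q m) + 2) * (3 * ?N) * ?L))))"
        by (intro mult_right_mono r_le_N) (use L in auto)
      also have "\<dots> = ?e * ?e * (6 * (real (q m) + 2) * (?N * ?N * (real k + 2))) * ?L"
        by (simp add: mult_ac)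
      also have "?e * ?e = exp (2 / (real m + 1)) ^ k"
        by (simp flip: power_mult_distrib exp_add)
      also have "?N * ?N * (real k + 2) = (real k + 2) ^ (2 * ?d + 1)"
        by (simp add: mult_2 power_add)
      finally show ?thesis
        by (simp add: a_def)
    qed
    \<comment> \<open>The measure is the same for every accuracy \<open>m\<close>, so for each
      \<open>k\<close> the best of the constants \<open>a k m\<close> may be taken.\<close>
    define M where "M k = (INF m. a k m)" for k
    have "(\<lambda>k. root k (M k)) \<longlonglongrightarrow> 1"
      unfolding M_def a_def by (rule root_INF_exp_poly_tendsto_1) simp
    then have "limsup (\<lambda>k. ereal (root k (M k))) = 1"
      by (intro lim_imp_Limsup) (auto simp: one_ereal_def)
    moreover have "(SUP z\<in>K. cmod (of_real (exp (- real k * Q z)) * p z))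
        \<le> M k * L2_norm \<nu> (\<lambda>z. of_real (exp (- real k * Q z)) * p z)"
      if p: "holomorphic_polynomial_of_degree_le k p" for k p
    proof (rule cSUP_least[OF \<open>K \<noteq> {}\<close>])
      fix x assume x: "x \<in> K"
      let ?L = "L2_norm \<nu> (\<lambda>z. of_real (exp (- real k * Q z)) * p z)"
      let ?s = "cmod (of_real (exp (- real k * Q x)) * p x)"
      have le: "?s \<le> a k m * ?L" for m
        by (rule bound[OF p x])
      show "?s \<le> M k * ?L"
      \<comment> \<open>Passing to the infimum over \<open>m\<close> divides by \<open>?L\<close>;
        if \<open>?L = 0\<close>, any single \<open>m\<close> already forces the left side to be
        0.\<close>
      proof (cases "?L = 0")
        case True
        then show ?thesis using le[of 0] by simp
      next
        case False
        then have "?L > 0" by (simp add: L2_norm_def less_le)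
        then have "?s / ?L \<le> M k"
          unfolding M_def using le by (intro cINF_greatest) (auto simp: divide_le_eq)
        with \<open>?L > 0\<close> show ?thesis by (simp add: divide_le_eq)
      qed
    qed
    ultimately show ?thesis
      unfolding weighted_Bernstein_Markov_def by blast
  qed
  ultimately show ?thesis
    unfolding strong_Bernstein_Markov_def by blast
qed

end
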